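(* Let $M\ge M^\star$. Then linearly damping the deviation from the cell average just enough to enforce nonnegativity of the retentional $\mathcal R^M(U):=M\,\mathcal C(U)-\mathcal B(U)$ retains order-$k$ local accuracy. That is: let $u_\delta:K\to[0,\infty)$ ($0<\delta\le\delta_0$) be a family of nonnegative exact solutions (in canonical coordinates of the mesh cell) and let $U_\delta\in\mathcal V$ have nonnegative cell average and satisfy $\sup_K|U_\delta-u_\delta|=O(\delta^{k+1})$ as $\delta\to 0$. Let $\overline U_\delta$ be the cell average of $U_\delta$, let $\mathrm dU_\delta:=U_\delta-\overline U_\delta$, let $\theta_\delta$ be the largest $\theta\in[0,1]$ with $\mathcal R^M(\overline U_\delta+\theta\,\mathrm dU_\delta)\ge 0$, and let $\widetilde U_\delta:=\overline U_\delta+\theta_\delta\,\mathrm dU_\delta$. Then $\sup_K|\widetilde U_\delta-u_\delta|=O(\delta^{k+1})$.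
   Context: $K\subset\mathbb R^D$ is a compact canonical mesh cell (with nonempty interior and boundary of positive finite area), independent of $\delta$, and $\mathcal V$ is a finite-dimensional space of polynomials containing all polynomials in $D$ variables of degree at most $k\ge 0$. $\mathcal C(U):=\int_K U$ and $\mathcal B(U):=\oint_{\partial K}U$. $\mathcal V_K^+:=\{U\in\mathcal V: U\ge0\text{ in }K,\ \mathcal C(U)>0\}$, and $M^\star:=\sup_{U\in\mathcal V_K^+}\frac{\mathcal B(U)}{\mathcal C(U)}$ is the optimal interior weight. The parameter $\delta$ plays the role of the physical mesh-cell diameter. *)

theory Defs
  imports "HOL-Analysis.Analysis" "HOL-Library.Function_Algebras"
begin

section \<open>Hausdorff measure\<close>

text \<open>
  The area functional on the boundary of the cell is integration against the
  (D-1)-dimensional Hausdorff measure, which agrees with classical surface area on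
  piecewise smooth hypersurfaces. The library has no Hausdorff measure, so it is built here by
  the usual covering construction, for natural exponents \<open>s\<close>. The factor
  \<open>unit_ball_vol s / 2 ^ s\<close> is the geometric normalisation.
\<close>

text \<open>
  With \<open>0 ^ 0 = 1\<close> a nonempty set has weight 1 for \<open>s = 0\<close> (counting measure,
  which is the boundary measure for \<open>D = 1\<close>); the empty set must be given weight 0 separately.
\<close>

definition hausdorff_gauge :: "nat \<Rightarrow> 'a::metric_space set \<Rightarrow> ennreal" where
  "hausdorff_gauge s S =
     (if S = {} then 0 else ennreal (unit_ball_vol (real s) * (diameter S / 2) ^ s))"

text \<open>
  Boundedness is required explicitly because \<open>diameter\<close> has no meaningful value for
  unbounded sets.
\<close>

definition hausdorff_pre :: "nat \<Rightarrow> real \<Rightarrow> 'a::metric_space set \<Rightarrow> ennreal" where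
  "hausdorff_pre s \<epsilon> A =
     (INF E\<in>{E :: nat \<Rightarrow> 'a set. A \<subseteq> (\<Union>i. E i) \<and> (\<forall>i. bounded (E i) \<and> diameter (E i) \<le> \<epsilon>)}.
        \<Sum>i. hausdorff_gauge s (E i))"

definition hausdorff_outer :: "nat \<Rightarrow> 'a::metric_space set \<Rightarrow> ennreal" where
  "hausdorff_outer s A = (SUP \<epsilon>\<in>{0<..}. hausdorff_pre s \<epsilon> A)"

definition hausdorff_measure :: "nat \<Rightarrow> 'a::metric_space measure" where
  "hausdorff_measure s = measure_of UNIV (sets borel) (hausdorff_outer s)"

lemma space_hausdorff_measure [simp]: "space (hausdorff_measure s) = UNIV"
  by (simp add: hausdorff_measure_def)

lemma sets_hausdorff_measure [simp, measurable_cong]: "sets (hausdorff_measure s) = sets borel"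
  unfolding hausdorff_measure_def
  by (metis sets.sigma_sets_eq sets_measure_of space_borel subset_Pow_Union sets.space_closed)

text \<open>
  \<open>measure_of\<close> returns the zero measure when its argument is not countably additive on
  the given sigma-algebra. The following lemmas show that this does not happen here.
\<close>

lemma hausdorff_pre_le:
  assumes "A \<subseteq> (\<Union>i. E i)" "\<And>i. bounded (E i)" "\<And>i. diameter (E i) \<le> \<epsilon>"
  shows "hausdorff_pre s \<epsilon> A \<le> (\<Sum>i. hausdorff_gauge s (E i))"
  unfolding hausdorff_pre_def using assms by (intro INF_lower) auto

lemma hausdorff_pre_mono:
  assumes "A \<subseteq> B" shows "hausdorff_pre s \<epsilon> A \<le> hausdorff_pre s \<epsilon> B"
  unfolding hausdorff_pre_def using assms by (intro INF_superset_mono) auto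

lemma hausdorff_pre_antimono:
  assumes "\<epsilon> \<le> \<epsilon>'" shows "hausdorff_pre s \<epsilon>' A \<le> hausdorff_pre s \<epsilon> A"
  unfolding hausdorff_pre_def using assms by (intro INF_superset_mono) (auto intro: order_trans)

lemma hausdorff_pre_empty: "0 < \<epsilon> \<Longrightarrow> hausdorff_pre s \<epsilon> {} = 0"
  using hausdorff_pre_le[of "{}" "\<lambda>_. {}" \<epsilon> s] by (simp add: hausdorff_gauge_def)

lemma hausdorff_pre_countably_subadditive:
  fixes A :: "nat \<Rightarrow> 'a::metric_space set"
  shows "hausdorff_pre s \<epsilon> (\<Union>i. A i) \<le> (\<Sum>n. hausdorff_pre s \<epsilon> (A n))"
proof (rule ennreal_le_epsilon)
  fix e :: real assume e: "0 < e" and "(\<Sum>n. hausdorff_pre s \<epsilon> (A n)) < top"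
  then have *: "hausdorff_pre s \<epsilon> (A n) < hausdorff_pre s \<epsilon> (A n) + e * (1/2)^Suc n" for n
    by (auto simp add: less_top dest!: ennreal_suminf_lessD)
  have "\<exists>B. A n \<subseteq> (\<Union>i. B i) \<and> (\<forall>i. bounded (B i) \<and> diameter (B i) \<le> \<epsilon>) \<and>
          (\<Sum>i. hausdorff_gauge s (B i)) < hausdorff_pre s \<epsilon> (A n) + e * (1/2)^Suc n" for n
    using *[of n] unfolding hausdorff_pre_def INF_less_iff by auto
  then obtain B where B: "\<And>n. A n \<subseteq> (\<Union>i. B n i)"
      "\<And>n i. bounded (B n i)" "\<And>n i. diameter (B n i) \<le> \<epsilon>"
    and Ble: "\<And>n. (\<Sum>i. hausdorff_gauge s (B n i)) \<le> hausdorff_pre s \<epsilon> (A n) + e * (1/2)^Suc n"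
    by (metis less_imp_le)
  define C where "C = case_prod B o prod_decode"
  have A_C: "(\<Union>i. A i) \<subseteq> (\<Union>i. C i)"
    using B(1) by (auto simp add: C_def subset_eq) (metis prod.case prod_encode_inverse)
  have "hausdorff_pre s \<epsilon> (\<Union>i. A i) \<le> (\<Sum>i. hausdorff_gauge s (C i))"
    using A_C B by (intro hausdorff_pre_le) (auto simp: C_def split: prod.split)
  also have "\<dots> = (\<Sum>n. \<Sum>i. hausdorff_gauge s (B n i))"
    unfolding C_def comp_def by (intro suminf_ennreal_2dimen) auto
  also have "\<dots> \<le> (\<Sum>n. hausdorff_pre s \<epsilon> (A n) + e * (1/2) ^ Suc n)"
    by (intro suminf_le allI Ble) auto
  also have "\<dots> = (\<Sum>n. hausdorff_pre s \<epsilon> (A n)) + (\<Sum>n. ennreal e * ennreal ((1/2) ^ Suc n))"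
    using e by (subst suminf_add[symmetric])
      (auto simp del: ennreal_suminf_cmult simp add: ennreal_mult[symmetric])
  also have "\<dots> = (\<Sum>n. hausdorff_pre s \<epsilon> (A n)) + e"
    unfolding ennreal_suminf_cmult
    by (subst suminf_ennreal_eq[OF zero_le_power power_half_series]) auto
  finally show "hausdorff_pre s \<epsilon> (\<Union>i. A i) \<le> (\<Sum>n. hausdorff_pre s \<epsilon> (A n)) + e" .
qed

lemma hausdorff_outer_empty: "hausdorff_outer s {} = 0"
  by (simp add: hausdorff_outer_def hausdorff_pre_empty)

lemma hausdorff_outer_mono:
  "A \<subseteq> B \<Longrightarrow> hausdorff_outer s A \<le> hausdorff_outer s B"
  unfolding hausdorff_outer_def by (intro SUP_mono) (auto intro: hausdorff_pre_mono)

lemma hausdorff_outer_countably_subadditive: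
  fixes A :: "nat \<Rightarrow> 'a::metric_space set"
  shows "hausdorff_outer s (\<Union>i. A i) \<le> (\<Sum>n. hausdorff_outer s (A n))"
  unfolding hausdorff_outer_def[of s "\<Union>i. A i"]
proof (rule SUP_least)
  fix \<epsilon> :: real assume e: "\<epsilon> \<in> {0<..}"
  have "hausdorff_pre s \<epsilon> (\<Union>i. A i) \<le> (\<Sum>n. hausdorff_pre s \<epsilon> (A n))"
    by (rule hausdorff_pre_countably_subadditive)
  also have "\<dots> \<le> (\<Sum>n. hausdorff_outer s (A n))"
    using e by (intro suminf_le) (auto simp: hausdorff_outer_def intro!: SUP_upper)
  finally show "hausdorff_pre s \<epsilon> (\<Union>i. A i) \<le> (\<Sum>n. hausdorff_outer s (A n))" .
qed

lemma outer_measure_space_hausdorff: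
  "outer_measure_space UNIV (hausdorff_outer s)"
  unfolding outer_measure_space_def positive_def increasing_def countably_subadditive_def
  by (auto simp: hausdorff_outer_empty intro: hausdorff_outer_mono hausdorff_outer_countably_subadditive)

lemma hausdorff_outer_Un_le:
  "hausdorff_outer s (A \<union> B) \<le> hausdorff_outer s A + hausdorff_outer s B"
proof -
  have "subadditive UNIV (hausdorff_outer s :: 'a set \<Rightarrow> ennreal)"
    using outer_measure_space_hausdorff[of s] algebra.axioms ring_of_sets.countably_subadditive_subadditive
      algebra_Pow[of UNIV]
    by (metis Pow_UNIV algebra.axioms(1) outer_measure_space_def)
  have "hausdorff_outer s (A \<union> B) = hausdorff_outer s (A \<union> (B - A))" by simp
  also have "\<dots> \<le> hausdorff_outer s A + hausdorff_outer s (B - A)"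
    using \<open>subadditive UNIV _\<close> by (intro subadditiveD) auto
  also have "\<dots> \<le> hausdorff_outer s A + hausdorff_outer s B"
    by (intro add_left_mono hausdorff_outer_mono) auto
  finally show ?thesis .
qed

lemma hausdorff_pre_separated:
  fixes A B :: "'a::metric_space set"
  assumes sep: "\<And>x y. x \<in> A \<Longrightarrow> y \<in> B \<Longrightarrow> r \<le> dist x y" and "0 < \<epsilon>" "\<epsilon> < r"
  shows "hausdorff_pre s \<epsilon> A + hausdorff_pre s \<epsilon> B \<le> hausdorff_pre s \<epsilon> (A \<union> B)"
  unfolding hausdorff_pre_def[of s \<epsilon> "A \<union> B"]
proof (rule INF_greatest, safe)
  fix E :: "nat \<Rightarrow> 'a set"
  assume E: "A \<union> B \<subseteq> (\<Union>i. E i)" and bd: "\<forall>i. bounded (E i) \<and> diameter (E i) \<le> \<epsilon>"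
  define E1 where "E1 i = (if E i \<inter> A = {} then {} else E i)" for i
  define E2 where "E2 i = (if E i \<inter> B = {} then {} else E i)" for i
  have "A \<subseteq> (\<Union>i. E1 i)" "B \<subseteq> (\<Union>i. E2 i)"
    using E unfolding E1_def E2_def by (fastforce split: if_splits)+
  moreover have "bounded (E1 i) \<and> diameter (E1 i) \<le> \<epsilon>" "bounded (E2 i) \<and> diameter (E2 i) \<le> \<epsilon>" for i
    using bd \<open>0 < \<epsilon>\<close> by (auto simp: E1_def E2_def)
  ultimately have 1: "hausdorff_pre s \<epsilon> A \<le> (\<Sum>i. hausdorff_gauge s (E1 i))"
    and 2: "hausdorff_pre s \<epsilon> B \<le> (\<Sum>i. hausdorff_gauge s (E2 i))"
    by (auto intro!: hausdorff_pre_le simp del: UN_iff)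
  have one: "E i \<inter> A = {} \<or> E i \<inter> B = {}" for i
  proof (rule ccontr)
    assume "\<not> ?thesis"
    then obtain x y where "x \<in> E i" "x \<in> A" "y \<in> E i" "y \<in> B" by auto
    then have "r \<le> dist x y" "dist x y \<le> diameter (E i)"
      using sep bd by (auto intro: diameter_bounded_bound)
    with bd \<open>\<epsilon> < r\<close> show False by (meson less_le_not_le order_trans)
  qed
  have "hausdorff_pre s \<epsilon> A + hausdorff_pre s \<epsilon> B
      \<le> (\<Sum>i. hausdorff_gauge s (E1 i)) + (\<Sum>i. hausdorff_gauge s (E2 i))"
    by (intro add_mono 1 2)
  also have "\<dots> = (\<Sum>i. hausdorff_gauge s (E1 i) + hausdorff_gauge s (E2 i))"
    by (rule suminf_add) auto
  also have "\<dots> \<le> (\<Sum>i. hausdorff_gauge s (E i))"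
    using one by (intro suminf_le) (auto simp: E1_def E2_def hausdorff_gauge_def)
  finally show "hausdorff_pre s \<epsilon> A + hausdorff_pre s \<epsilon> B \<le> (\<Sum>i. hausdorff_gauge s (E i))" .
qed

lemma hausdorff_outer_separated:
  fixes A B :: "'a::metric_space set"
  assumes sep: "\<And>x y. x \<in> A \<Longrightarrow> y \<in> B \<Longrightarrow> r \<le> dist x y" and "0 < r"
  shows "hausdorff_outer s A + hausdorff_outer s B \<le> hausdorff_outer s (A \<union> B)"
proof -
  have "hausdorff_outer s A + hausdorff_outer s B
      = (SUP \<epsilon>\<in>{0<..}. hausdorff_pre s \<epsilon> A + hausdorff_pre s \<epsilon> B)"
    unfolding hausdorff_outer_def
  proof (rule SUP_add_directed_ennreal[symmetric])
    fix i j :: real assume "i \<in> {0<..}" "j \<in> {0<..}"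
    then show "\<exists>k\<in>{0<..}. hausdorff_pre s i A + hausdorff_pre s j B
        \<le> hausdorff_pre s k A + hausdorff_pre s k B"
      by (intro bexI[of _ "min i j"] add_mono hausdorff_pre_antimono) auto
  qed
  also have "\<dots> \<le> hausdorff_outer s (A \<union> B)"
  proof (rule SUP_least)
    fix \<epsilon> :: real assume e: "\<epsilon> \<in> {0<..}"
    define \<eta> where "\<eta> = min \<epsilon> (r / 2)"
    have \<eta>: "0 < \<eta>" "\<eta> \<le> \<epsilon>" "\<eta> < r" using e \<open>0 < r\<close> by (auto simp: \<eta>_def)
    have "hausdorff_pre s \<epsilon> A + hausdorff_pre s \<epsilon> B \<le> hausdorff_pre s \<eta> A + hausdorff_pre s \<eta> B"
      using \<eta> by (intro add_mono hausdorff_pre_antimono)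
    also have "\<dots> \<le> hausdorff_pre s \<eta> (A \<union> B)"
      using sep \<eta> by (intro hausdorff_pre_separated[of A B r])
    also have "\<dots> \<le> hausdorff_outer s (A \<union> B)"
      unfolding hausdorff_outer_def using \<eta> by (intro SUP_upper) auto
    finally show "hausdorff_pre s \<epsilon> A + hausdorff_pre s \<epsilon> B \<le> hausdorff_outer s (A \<union> B)" .
  qed
  finally show ?thesis .
qed

lemma hausdorff_outer_sum_separated:
  fixes A :: "nat \<Rightarrow> 'a::metric_space set"
  assumes sep: "\<And>i j x y. i < j \<Longrightarrow> x \<in> A i \<Longrightarrow> y \<in> A j \<Longrightarrow> r j \<le> dist x y"
    and "\<And>j. 0 < r j"
  shows "(\<Sum>i<n. hausdorff_outer s (A i)) \<le> hausdorff_outer s (\<Union>i<n. A i)"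
proof (induction n)
  case (Suc n)
  have "(\<Sum>i<Suc n. hausdorff_outer s (A i))
      \<le> hausdorff_outer s (\<Union>i<n. A i) + hausdorff_outer s (A n)"
    using Suc.IH by (simp add: add_right_mono)
  also have "\<dots> \<le> hausdorff_outer s ((\<Union>i<n. A i) \<union> A n)"
    using assms by (intro hausdorff_outer_separated[of _ _ "r n"]) auto
  also have "(\<Union>i<n. A i) \<union> A n = (\<Union>i<Suc n. A i)" by (auto simp: less_Suc_eq)
  finally show ?case .
qed (simp add: hausdorff_outer_empty)

lemma closed_caratheodory_hausdorff:
  fixes F A :: "'a::metric_space set"
  assumes "closed F"
  shows "hausdorff_outer s (A \<inter> F) + hausdorff_outer s (A - F) \<le> hausdorff_outer s A"
proof (cases "F = {} \<or> hausdorff_outer s A = top")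
  case True
  then show ?thesis by (auto simp: hausdorff_outer_empty)
next
  case False
  then have ne: "F \<noteq> {}" and fin: "hausdorff_outer s A \<noteq> top" by auto
  define P where "P n = {x \<in> A. 1 / Suc n \<le> infdist x F}" for n
  define R where "R n = {x \<in> A. 1 / Suc (Suc n) \<le> infdist x F \<and> infdist x F < 1 / Suc n}" for n
  have Rsep: "1 / Suc (Suc i) - 1 / Suc j \<le> dist x y" if "x \<in> R i" "y \<in> R j" for i j x y
    using that infdist_triangle[of x F y] by (auto simp: R_def)
  have even_odd: "(\<Sum>i<n. hausdorff_outer s (R (2 * i + c))) \<le> hausdorff_outer s A" for n c
  proof -
    have "(\<Sum>i<n. hausdorff_outer s (R (2 * i + c))) \<le> hausdorff_outer s (\<Union>i<n. R (2 * i + c))"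
    proof (rule hausdorff_outer_sum_separated[where
          r = "\<lambda>j. if j = 0 then 1 else 1 / real (2 * j + c) - 1 / real (Suc (2 * j + c))"])
      fix i j :: nat and x y
      assume ij: "i < j" and xy: "x \<in> R (2 * i + c)" "y \<in> R (2 * j + c)"
      have "1 / real (2 * j + c) \<le> 1 / real (Suc (Suc (2 * i + c)))"
        using ij by (intro divide_left_mono) auto
      with Rsep[OF xy] ij
      show "(if j = 0 then 1 else 1 / real (2 * j + c) - 1 / real (Suc (2 * j + c))) \<le> dist x y"
        by simp
    next
      fix j :: nat
      show "0 < (if j = 0 then 1 else 1 / real (2 * j + c) - 1 / real (Suc (2 * j + c)))"
        by (simp add: frac_less2)
    qed
    also have "\<dots> \<le> hausdorff_outer s A"
      by (intro hausdorff_outer_mono) (auto simp: R_def)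
    finally show ?thesis .
  qed
  define h where "h n = enn2real (hausdorff_outer s (R n))" for n
  have "hausdorff_outer s (R n) \<noteq> top" for n
    using hausdorff_outer_mono[of "R n" A s] fin by (auto simp: R_def top_unique)
  then have h: "hausdorff_outer s (R n) = ennreal (h n)" for n
    by (simp add: h_def less_top)
  have h0: "0 \<le> h n" for n by (simp add: h_def)
  have "summable h"
  proof (rule summableI_nonneg_bounded[OF h0])
    fix n
    have "(\<Sum>i<n. hausdorff_outer s (R i)) \<le> (\<Sum>i<2*n. hausdorff_outer s (R i))"
      by (intro sum_mono2) auto
    also have "\<dots> = (\<Sum>i<n. hausdorff_outer s (R (2 * i + 0))) + (\<Sum>i<n. hausdorff_outer s (R (2 * i + 1)))"
      by (induction n) (auto simp: algebra_simps)
    also have "\<dots> \<le> hausdorff_outer s A + hausdorff_outer s A"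
      by (intro add_mono even_odd)
    also have "\<dots> = ennreal (2 * enn2real (hausdorff_outer s A))"
      using fin by (cases "hausdorff_outer s A") (auto simp: ennreal_plus[symmetric] simp del: ennreal_plus)
    finally show "(\<Sum>i<n. h i) \<le> 2 * enn2real (hausdorff_outer s A)"
      unfolding h by (simp add: sum_ennreal h0)
  qed
  show ?thesis
  proof (rule ennreal_le_epsilon)
    fix e :: real assume "0 < e"
    then obtain n where n: "norm (\<Sum>i. h (i + n)) < e"
      using suminf_exist_split[OF _ \<open>summable h\<close>] by blast
    have tail: "(\<Sum>i. hausdorff_outer s (R (i + n))) \<le> ennreal e"
      unfolding h using n h0 \<open>summable h\<close>
      by (subst suminf_ennreal2) (auto intro!: ennreal_leI)
    have "A - F \<subseteq> P n \<union> (\<Union>i. R (i + n))"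
    proof
      fix x assume x: "x \<in> A - F"
      then have pos: "0 < infdist x F"
        using ne \<open>closed F\<close> by (intro infdist_pos_not_in_closed) auto
      show "x \<in> P n \<union> (\<Union>i. R (i + n))"
      proof (cases "x \<in> P n")
        case False
        then have lt: "infdist x F < 1 / Suc n" using x by (auto simp: P_def)
        define m where "m = (LEAST m. 1 / Suc m \<le> infdist x F)"
        obtain m0 where "1 / Suc m0 \<le> infdist x F"
          using pos reals_Archimedean[of "infdist x F"] by (auto simp: inverse_eq_divide intro: less_imp_le)
        then have m: "1 / Suc m \<le> infdist x F" unfolding m_def by (rule LeastI)
        have nm: "n < m"
        proof (rule ccontr)
          assume "\<not> n < m"
          then have "1 / Suc n \<le> 1 / Suc m" by (intro divide_left_mono) auto
          with m lt show False by linarith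
        qed
        then obtain j where j: "m = Suc (j + n)" by (metis add.commute less_imp_Suc_add)
        have "\<not> 1 / Suc (j + n) \<le> infdist x F"
          using not_less_Least[of "j + n" "\<lambda>m. 1 / Suc m \<le> infdist x F"] j unfolding m_def by simp
        then have "x \<in> R (j + n)" using m x unfolding j R_def by auto
        then show ?thesis by blast
      qed auto
    qed
    then have "hausdorff_outer s (A - F) \<le> hausdorff_outer s (P n \<union> (\<Union>i. R (i + n)))"
      by (rule hausdorff_outer_mono)
    also have "\<dots> \<le> hausdorff_outer s (P n) + hausdorff_outer s (\<Union>i. R (i + n))"
      by (rule hausdorff_outer_Un_le)
    also have "\<dots> \<le> hausdorff_outer s (P n) + ennreal e"
      by (intro add_left_mono order_trans[OF hausdorff_outer_countably_subadditive tail])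
    finally have "hausdorff_outer s (A \<inter> F) + hausdorff_outer s (A - F)
        \<le> (hausdorff_outer s (A \<inter> F) + hausdorff_outer s (P n)) + ennreal e"
      by (metis add.assoc add_left_mono)
    also have "hausdorff_outer s (A \<inter> F) + hausdorff_outer s (P n) \<le> hausdorff_outer s (A \<inter> F \<union> P n)"
    proof (rule hausdorff_outer_separated[of _ _ "1 / Suc n"])
      fix x y assume "x \<in> A \<inter> F" "y \<in> P n"
      then show "1 / Suc n \<le> dist x y"
        using infdist_le[of x F y] by (auto simp: P_def dist_commute)
    qed simp
    also have "\<dots> \<le> hausdorff_outer s A"
      by (intro hausdorff_outer_mono) (auto simp: P_def)
    finally show "hausdorff_outer s (A \<inter> F) + hausdorff_outer s (A - F) \<le> hausdorff_outer s A + ennreal e"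
      by (simp add: add_right_mono)
  qed
qed

lemma borel_subset_lambda_system_hausdorff:
  "sets borel \<subseteq> lambda_system UNIV UNIV (hausdorff_outer s :: 'a::metric_space set \<Rightarrow> ennreal)"
proof -
  interpret sigma_algebra UNIV "UNIV :: 'a set set"
    using sigma_algebra_Pow[of UNIV] by simp
  have "measure_space UNIV (lambda_system UNIV UNIV (hausdorff_outer s)) (hausdorff_outer s :: 'a set \<Rightarrow> ennreal)"
    by (rule caratheodory_lemma[OF outer_measure_space_hausdorff])
  then interpret L: sigma_algebra UNIV "lambda_system UNIV UNIV (hausdorff_outer s :: 'a set \<Rightarrow> ennreal)"
    by (simp add: measure_space_def)
  have "F \<in> lambda_system UNIV UNIV (hausdorff_outer s)" if "closed F" for F :: "'a set"
  proof -
    have "hausdorff_outer s (A \<inter> F) + hausdorff_outer s (A - F) = hausdorff_outer s A" for A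
      using closed_caratheodory_hausdorff[OF that] hausdorff_outer_Un_le[of s "A \<inter> F" "A - F"]
      by (metis Int_Diff_Un antisym)
    then show ?thesis by (simp add: lambda_system_eq)
  qed
  then have "sigma_sets UNIV (Collect closed) \<subseteq> lambda_system UNIV UNIV (hausdorff_outer s :: 'a set \<Rightarrow> ennreal)"
    by (intro L.sigma_sets_subset) auto
  then show ?thesis by (simp add: borel_eq_closed)
qed

lemma measure_space_hausdorff:
  "measure_space UNIV (sets borel) (hausdorff_outer s :: 'a::metric_space set \<Rightarrow> ennreal)"
proof -
  interpret sigma_algebra UNIV "UNIV :: 'a set set"
    using sigma_algebra_Pow[of UNIV] by simp
  have "measure_space UNIV (lambda_system UNIV UNIV (hausdorff_outer s)) (hausdorff_outer s :: 'a set \<Rightarrow> ennreal)"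
    by (rule caratheodory_lemma[OF outer_measure_space_hausdorff])
  then show ?thesis
    using borel_subset_lambda_system_hausdorff[of s] sets.sigma_algebra_axioms[of "borel :: 'a measure"]
    unfolding measure_space_def positive_def countably_additive_def by (auto; blast)
qed

proposition emeasure_hausdorff_measure:
  "A \<in> sets borel \<Longrightarrow> emeasure (hausdorff_measure s) A = hausdorff_outer s A"
  using measure_space_hausdorff[of s] unfolding hausdorff_measure_def measure_space_def
  by (intro emeasure_measure_of_sigma) auto

section \<open>Polynomial spaces\<close>

text \<open>
  Polynomials are identified with polynomial functions on the whole space. The scalar action on
  functions is written out because functions are not an instance of \<open>real_vector\<close>.
\<close>

global_interpretation fun_vs: vector_space "\<lambda>(c::real) (f :: 'a \<Rightarrow> real) x. c * f x"
  by unfold_locales (auto simp: fun_eq_iff algebra_simps)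

definition finite_dimensional_poly_space :: "(real ^ 'd \<Rightarrow> real) set \<Rightarrow> bool" where
  "finite_dimensional_poly_space V \<longleftrightarrow>
     fun_vs.subspace V \<and> (\<exists>F. finite F \<and> fun_vs.span F = V) \<and> (\<forall>f\<in>V. real_polynomial_function f)"

definition polys_of_degree_le :: "nat \<Rightarrow> (real ^ 'd \<Rightarrow> real) set" where
  "polys_of_degree_le k =
     fun_vs.span {(\<lambda>x. \<Prod>i\<in>UNIV. (x $ i) ^ \<alpha> i) |\<alpha>. (\<Sum>i\<in>UNIV. \<alpha> i) \<le> k}"

section \<open>Cell and boundary functionals\<close>

definition cell_integral :: "(real ^ 'd) set \<Rightarrow> (real ^ 'd \<Rightarrow> real) \<Rightarrow> real" where
  "cell_integral K U = (LINT x:K|lborel. U x)"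

definition boundary_integral :: "(real ^ 'd) set \<Rightarrow> (real ^ 'd \<Rightarrow> real) \<Rightarrow> real" where
  "boundary_integral K U = (LINT x:frontier K|hausdorff_measure (CARD('d) - 1). U x)"

definition boundary_area :: "(real ^ 'd) set \<Rightarrow> ennreal" where
  "boundary_area K = emeasure (hausdorff_measure (CARD('d) - 1)) (frontier K)"

definition cell_average :: "(real ^ 'd) set \<Rightarrow> (real ^ 'd \<Rightarrow> real) \<Rightarrow> real" where
  "cell_average K U = cell_integral K U / measure lborel K"

definition positive_polys :: "(real ^ 'd) set \<Rightarrow> (real ^ 'd \<Rightarrow> real) set \<Rightarrow> (real ^ 'd \<Rightarrow> real) set" where
  "positive_polys K V = {U \<in> V. (\<forall>x\<in>K. 0 \<le> U x) \<and> 0 < cell_integral K U}"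

text \<open>The supremum is taken in the extended reals, so that no boundedness is presupposed.\<close>

definition optimal_interior_weight :: "(real ^ 'd) set \<Rightarrow> (real ^ 'd \<Rightarrow> real) set \<Rightarrow> ereal" where
  "optimal_interior_weight K V =
     (SUP U\<in>positive_polys K V. ereal (boundary_integral K U / cell_integral K U))"

definition retentional :: "(real ^ 'd) set \<Rightarrow> real \<Rightarrow> (real ^ 'd \<Rightarrow> real) \<Rightarrow> real" where
  "retentional K M U = M * cell_integral K U - boundary_integral K U"

definition damp :: "(real ^ 'd) set \<Rightarrow> real \<Rightarrow> (real ^ 'd \<Rightarrow> real) \<Rightarrow> real ^ 'd \<Rightarrow> real" where
  "damp K \<theta> U = (\<lambda>x. cell_average K U + \<theta> * (U x - cell_average K U))"

definition damping_factor :: "(real ^ 'd) set \<Rightarrow> real \<Rightarrow> (real ^ 'd \<Rightarrow> real) \<Rightarrow> real" where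
  "damping_factor K M U =
     (GREATEST \<theta>. \<theta> \<in> {0..1} \<and> 0 \<le> retentional K M (damp K \<theta> U))"

definition limited :: "(real ^ 'd) set \<Rightarrow> real \<Rightarrow> (real ^ 'd \<Rightarrow> real) \<Rightarrow> real ^ 'd \<Rightarrow> real" where
  "limited K M U = damp K (damping_factor K M U) U"

text \<open>
  \<open>sup\<^sub>K |U\<^sub>\<delta> - u\<^sub>\<delta>| = O(\<delta> ^ m)\<close> as \<open>\<delta>\<close> tends to 0 from above. The
  supremum is extended-real-valued, so the bound includes finiteness of the supremum for small
  \<open>\<delta>\<close>; a real-valued supremum would be meaningless for unbounded differences.
\<close>

definition sup_error_bigo ::
  "'a set \<Rightarrow> nat \<Rightarrow> (real \<Rightarrow> 'a \<Rightarrow> real) \<Rightarrow> (real \<Rightarrow> 'a \<Rightarrow> real) \<Rightarrow> bool" where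
  "sup_error_bigo K m U u \<longleftrightarrow>
     (\<exists>C. \<forall>\<^sub>F \<delta> in at_right 0. (SUP x\<in>K. ereal \<bar>U \<delta> x - u \<delta> x\<bar>) \<le> ereal (C * \<delta> ^ m))"

end

theory Submission
  imports Defs
begin

text \<open>
  Write \<open>A\<close> for the cell average of \<open>U\<close>, \<open>R\<close> for the retentional, and let
  \<open>\<epsilon>\<close> bound the error \<open>\<bar>U - u\<bar>\<close> on \<open>K\<close>. Since \<open>u\<close> is nonnegative,
  \<open>U + \<epsilon>\<close> is nonnegative on \<open>K\<close>, so \<open>R (U + \<epsilon>) \<ge> 0\<close> by the choice of
  \<open>M\<close> (lemma \<open>retentional_nonneg\<close>): the retentional of \<open>U\<close> is negative by at most
  \<open>\<epsilon> R(1)\<close>. As \<open>R (A + \<theta> (U - A)) = (1 - \<theta>) A R(1) + \<theta> R(U)\<close> is affine in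
  \<open>\<theta>\<close>, the largest admissible \<open>\<theta>\<close> can be computed, and this lower bound on
  \<open>R(U)\<close> becomes \<open>(1 - \<theta>) (A + \<epsilon>) \<le> \<epsilon>\<close> (lemma \<open>damping_le\<close>).

  This does not make \<open>1 - \<theta>\<close> small when \<open>A\<close> is of the order of \<open>\<epsilon>\<close> or
  less, but then \<open>U\<close> itself is small: on a finite-dimensional space of polynomials the supremum
  of a nonnegative member over \<open>K\<close> is at most a constant \<open>C\<close> times its average (lemma
  \<open>sup_le_average\<close>). Applied to \<open>U + \<epsilon>\<close>, whose average is \<open>A + \<epsilon>\<close>, this
  gives \<open>\<bar>U - A\<bar> \<le> C (A + \<epsilon>)\<close>. The factor \<open>A + \<epsilon>\<close> cancels in the product,
  so the limiter moves \<open>U\<close> by \<open>(1 - \<theta>) \<bar>U - A\<bar> \<le> C \<epsilon>\<close>, with \<open>C\<close>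
  depending only on \<open>K\<close> and the polynomial space.
\<close>

section \<open>Polynomials and integrals over compact sets\<close>

text \<open>
  On the line joining any point to a ball inside the open set, the polynomial is univariate and has
  infinitely many zeros.
\<close>

lemma real_polynomial_function_zero_if_zero_on_open:
  fixes f :: "'a::real_normed_vector \<Rightarrow> real"
  assumes f: "real_polynomial_function f" and S: "open S" "S \<noteq> {}" and 0: "\<And>x. x \<in> S \<Longrightarrow> f x = 0"
  shows "f x = 0"
proof -
  obtain c r where "0 < r" and r: "ball c r \<subseteq> S"
    using S open_contains_ball by (metis ex_in_conv)
  define h where "h = (\<lambda>t::real. c + t *\<^sub>R (x - c))"
  have "polynomial_function h"
    unfolding h_def by (intro polynomial_function_add polynomial_function_const
        polynomial_function_mult polynomial_function_id)
  then have "real_polynomial_function (f \<circ> h)"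
    using f by (rule real_polynomial_function_compose)
  then obtain a and n :: nat where a: "f \<circ> h = (\<lambda>t. \<Sum>i\<le>n. a i * t ^ i)"
    using real_polynomial_function_imp_sum by blast
  \<comment> \<open>The segment of parameters below \<open>s\<close> stays in the ball; the summand 1 covers \<open>x = c\<close>.\<close>
  define s where "s = r / (norm (x - c) + 1)"
  have "0 < s"
    using \<open>0 < r\<close> by (simp add: s_def add_nonneg_pos)
  have "(f \<circ> h) t = 0" if "t \<in> {0<..<s}" for t
  proof -
    have "t * norm (x - c) \<le> t * (norm (x - c) + 1)"
      using that by (intro mult_left_mono) auto
    also have "\<dots> < s * (norm (x - c) + 1)"
      using that by (intro mult_strict_right_mono) (auto intro: add_nonneg_pos)
    also have "\<dots> = r"
      unfolding s_def using add_nonneg_pos[of "norm (x - c)" 1] by simp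
    finally have "h t \<in> ball c r"
      using that by (simp add: h_def dist_norm)
    then show ?thesis
      using r 0 by auto
  qed
  then have "{0<..<s} \<subseteq> {t. (\<Sum>i\<le>n. a i * t ^ i) = 0}"
    unfolding a by auto
  then have "infinite {t. (\<Sum>i\<le>n. a i * t ^ i) = 0}"
    using \<open>0 < s\<close> infinite_Ioo infinite_super by blast
  then have "\<forall>i\<le>n. a i = 0"
    by (simp add: polyfun_finite_roots)
  then have "(f \<circ> h) 1 = 0"
    unfolding a by simp
  then show ?thesis
    by (simp add: h_def)
qed

lemma set_integrable_continuous_compact:
  fixes f :: "'a::t2_space \<Rightarrow> real"
  assumes "sets M = sets borel" "compact A" "emeasure M A < \<infinity>" "continuous_on UNIV f"
  shows "set_integrable M A f"
proof -
  have "bounded (f ` A)"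
    using assms by (meson compact_continuous_image compact_imp_bounded continuous_on_subset subset_UNIV)
  then obtain B where "\<And>x. x \<in> A \<Longrightarrow> norm (f x) \<le> B"
    by (auto simp: bounded_iff)
  moreover have "A \<in> sets M" "f \<in> borel_measurable M"
    using assms by (auto simp: borel_measurable_continuous_onI compact_imp_closed
        measurable_cong_sets[OF assms(1) refl])
  ultimately show ?thesis
    unfolding set_integrable_def using assms(3) by (intro integrableI_bounded_set_indicator) auto
qed

lemma zero_on_interior_if_integral_abs_zero:
  fixes f :: "'a::euclidean_space \<Rightarrow> real"
  assumes K: "compact K" and f: "continuous_on UNIV f"
    and 0: "(LINT x:K|lborel. \<bar>f x\<bar>) = 0" and x: "x \<in> interior K"
  shows "f x = 0"
proof -
  have "set_integrable lborel K (\<lambda>x. \<bar>f x\<bar>)"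
    using K f emeasure_compact_finite
    by (intro set_integrable_continuous_compact continuous_intros) auto
  then have "AE x in lborel. indicator K x *\<^sub>R \<bar>f x\<bar> = 0"
    using 0 unfolding set_integrable_def set_lebesgue_integral_def
    by (subst (asm) integral_nonneg_eq_0_iff_AE) auto
  then have ae: "AE x in lborel. x \<notin> {x \<in> interior K. f x \<noteq> 0}"
    using interior_subset[of K] by (auto simp: indicator_def elim!: eventually_mono split: if_splits)
  have op: "open {x \<in> interior K. f x \<noteq> 0}"
  proof -
    have "{x \<in> interior K. f x \<noteq> 0} = interior K \<inter> f -` (- {0})" by auto
    then show ?thesis using f by (metis open_Int open_interior open_vimage open_Compl closed_singleton)
  qed
  then have "{x \<in> interior K. f x \<noteq> 0} \<in> null_sets lborel"
    using ae by (subst AE_iff_null_sets) auto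
  then have "negligible {x \<in> interior K. f x \<noteq> 0}"
    by (simp add: negligible_iff_null_sets null_sets_completionI)
  then have "{x \<in> interior K. f x \<noteq> 0} = {}"
    using op open_not_negligible by blast
  then show ?thesis using x by auto
qed

section \<open>Definite seminorms on coefficient vectors\<close>

text \<open>
  The equivalence of norms in finite dimension: \<open>\<nu>\<close> is continuous, hence attains a minimum on
  the compact \<open>\<ell>\<^sup>1\<close> unit sphere, and definiteness makes that minimum positive. Coefficient vectors
  are functions on the whole type, so that the dimension can be the cardinality of an arbitrary
  finite set; the hypothesis \<open>local\<close> says that only the entries in \<open>B\<close> count.
\<close>

lemma definite_seminorm_bounds_coefficients:
  fixes B :: "'b set" and \<nu> :: "('b \<Rightarrow> real) \<Rightarrow> real"
  assumes B: "finite B"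
    and scale: "\<And>c a. \<nu> (\<lambda>b. c * a b) = \<bar>c\<bar> * \<nu> a"
    and triangle: "\<And>a a'. \<nu> (\<lambda>b. a b + a' b) \<le> \<nu> a + \<nu> a'"
    and local: "\<And>a a'. (\<And>b. b \<in> B \<Longrightarrow> a b = a' b) \<Longrightarrow> \<nu> a = \<nu> a'"
    and definite: "\<And>a b. \<nu> a = 0 \<Longrightarrow> b \<in> B \<Longrightarrow> a b = 0"
  shows "\<exists>C. \<forall>a. (\<Sum>b\<in>B. \<bar>a b\<bar>) \<le> C * \<nu> a"
proof (cases "B = {}")
  case True
  have "\<nu> (\<lambda>b. 0 * undefined b) = \<bar>0\<bar> * \<nu> undefined"
    by (rule scale)
  then have "\<nu> a = 0" for a
    using local[of a "\<lambda>b. 0"] True by simp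
  then show ?thesis
    using True by simp
next
  case False
  have zero: "\<nu> (\<lambda>b. 0) = 0"
    using scale[of 0 "\<lambda>b. 0"] by simp
  have neg: "\<nu> (\<lambda>b. - a b) = \<nu> a" for a
    using scale[of "-1" a] by simp
  have nonneg: "0 \<le> \<nu> a" for a
    using triangle[of a "\<lambda>b. - a b"] by (simp add: zero neg)
  define e where "e b = (\<lambda>b'. if b' = b then 1 else 0 :: real)" for b :: 'b
  have upper: "\<nu> (\<lambda>b. if b \<in> F then a b else 0) \<le> (\<Sum>b\<in>F. \<bar>a b\<bar> * \<nu> (e b))" if "finite F" for F a
    using that
  proof induction
    case (insert g F)
    have "(\<lambda>b. if b \<in> insert g F then a b else 0) = (\<lambda>b. (a g * e g b) + (if b \<in> F then a b else 0))"
      using insert by (auto simp: e_def)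
    then have "\<nu> (\<lambda>b. if b \<in> insert g F then a b else 0)
        \<le> \<nu> (\<lambda>b. a g * e g b) + \<nu> (\<lambda>b. if b \<in> F then a b else 0)"
      using triangle by metis
    then show ?case
      using insert by (simp add: scale)
  qed (simp add: zero)
  have lip: "\<bar>\<nu> a - \<nu> a'\<bar> \<le> (\<Sum>b\<in>B. \<bar>a b - a' b\<bar> * \<nu> (e b))" for a a'
  proof -
    have *: "\<nu> a \<le> \<nu> a' + (\<Sum>b\<in>B. \<bar>a b - a' b\<bar> * \<nu> (e b))" for a a'
    proof -
      have "\<nu> a \<le> \<nu> a' + \<nu> (\<lambda>b. a b - a' b)"
        using triangle[of a' "\<lambda>b. a b - a' b"] by simp
      also have "\<nu> (\<lambda>b. a b - a' b) = \<nu> (\<lambda>b. if b \<in> B then a b - a' b else 0)"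
        by (rule local) simp
      finally show ?thesis
        using upper[OF B, of "\<lambda>b. a b - a' b"] by simp
    qed
    show ?thesis
      using *[of a a'] *[of a' a] by (simp add: abs_minus_commute)
  qed
  have cont: "continuous_on UNIV \<nu>"
    unfolding continuous_on_def
  proof
    fix a :: "'b \<Rightarrow> real"
    have "((\<lambda>x. x b) \<longlongrightarrow> a b) (at a)" for b :: 'b
      using continuous_on_product_coordinates[of b] unfolding continuous_on_def by blast
    then have "((\<lambda>x. \<Sum>b\<in>B. \<bar>x b - a b\<bar> * \<nu> (e b)) \<longlongrightarrow> (\<Sum>b\<in>B. \<bar>a b - a b\<bar> * \<nu> (e b))) (at a)"
      by (intro tendsto_intros)
    then have "((\<lambda>x. \<Sum>b\<in>B. \<bar>x b - a b\<bar> * \<nu> (e b)) \<longlongrightarrow> 0) (at a)"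
      by simp
    then have "((\<lambda>x. \<nu> x - \<nu> a) \<longlongrightarrow> 0) (at a)"
      by (rule Lim_null_comparison[rotated]) (use lip in simp)
    then show "(\<nu> \<longlongrightarrow> \<nu> a) (at a)"
      by (simp add: LIM_zero_iff)
  qed
  \<comment> \<open>Freezing the coordinates outside \<open>B\<close> at 0 makes the sphere part of a product of compact
    sets, to which Tychonoff's theorem applies.\<close>
  define P where "P = (\<Pi>\<^sub>E b\<in>UNIV. if b \<in> B then {-1..1} else {0::real})"
  define S where "S = P \<inter> {a. (\<Sum>b\<in>B. \<bar>a b\<bar>) = 1}"
  have "compactin (product_topology (\<lambda>_. euclidean) UNIV) P"
    unfolding P_def compactin_PiE by auto
  then have "compact P"
    by (simp add: euclidean_product_topology)
  moreover have "closed {a. (\<Sum>b\<in>B. \<bar>a b\<bar>) = (1::real)}"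
    by (intro closed_Collect_eq continuous_intros) auto
  ultimately have "compact S"
    unfolding S_def by (rule compact_Int_closed)
  obtain g where "g \<in> B" using False by blast
  have "e g \<in> S"
    using \<open>g \<in> B\<close> B by (auto simp: S_def P_def e_def if_distrib cong: if_cong)
  then obtain m where m: "m \<in> S" and min: "\<And>a. a \<in> S \<Longrightarrow> \<nu> m \<le> \<nu> a"
    using continuous_attains_inf[OF \<open>compact S\<close> _ continuous_on_subset[OF cont]] by blast
  have "\<nu> m \<noteq> 0"
    using definite[of m] m by (auto simp: S_def)
  then have pos: "0 < \<nu> m"
    using nonneg[of m] by simp
  have "(\<Sum>b\<in>B. \<bar>a b\<bar>) \<le> inverse (\<nu> m) * \<nu> a" for a
  proof (cases "(\<Sum>b\<in>B. \<bar>a b\<bar>) = 0")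
    case True
    then show ?thesis using pos nonneg[of a] by simp
  next
    case False
    define s where "s = (\<Sum>b\<in>B. \<bar>a b\<bar>)"
    have "0 < s"
      using False unfolding s_def by (metis abs_ge_zero order_le_imp_less_or_eq sum_nonneg)
    have le: "\<bar>a b\<bar> \<le> s" if "b \<in> B" for b
      unfolding s_def using B that by (intro member_le_sum) auto
    define a' where "a' = (\<lambda>b. if b \<in> B then inverse s * a b else 0)"
    have "a' b \<in> {-1..1}" if "b \<in> B" for b
      using le[OF that] \<open>0 < s\<close> that by (auto simp: a'_def field_simps abs_le_iff)
    then have "a' \<in> P"
      by (auto simp: P_def a'_def)
    moreover have "(\<Sum>b\<in>B. \<bar>a' b\<bar>) = (\<Sum>b\<in>B. inverse s * \<bar>a b\<bar>)"
      using \<open>0 < s\<close> by (intro sum.cong) (auto simp: a'_def abs_mult)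
    then have "(\<Sum>b\<in>B. \<bar>a' b\<bar>) = inverse s * s"
      by (simp only: s_def sum_distrib_left)
    ultimately have "a' \<in> S"
      using \<open>0 < s\<close> by (simp add: S_def)
    then have "\<nu> m \<le> \<nu> a'"
      by (rule min)
    also have "\<nu> a' = \<nu> (\<lambda>b. inverse s * a b)"
      by (rule local) (simp add: a'_def)
    also have "\<dots> = inverse s * \<nu> a"
      using \<open>0 < s\<close> by (simp add: scale)
    finally show ?thesis
      unfolding s_def[symmetric] using pos \<open>0 < s\<close> by (simp add: field_simps)
  qed
  then show ?thesis by blast
qed

lemma sum_fun_apply: "(\<Sum>b\<in>B. g b) x = (\<Sum>b\<in>B. g b x :: real)"
  by (induction B rule: infinite_finite_induct) auto

section \<open>Functionals on a mesh cell\<close>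

locale mesh_cell =
  fixes K :: "(real ^ 'd) set" and V :: "(real ^ 'd \<Rightarrow> real) set"
  assumes compact: "compact K" and interior: "interior K \<noteq> {}"
    and area: "boundary_area K < \<infinity>"
    and V: "finite_dimensional_poly_space V" and one: "(\<lambda>x. 1) \<in> V"
begin

lemma poly: "f \<in> V \<Longrightarrow> real_polynomial_function f"
  using V by (simp add: finite_dimensional_poly_space_def)

lemma continuous: "f \<in> V \<Longrightarrow> continuous_on A f"
  using poly continuous_on_polymonial_function real_polynomial_function_eq by blast

lemma nonempty: "K \<noteq> {}"
  using interior interior_subset by blast

lemma combination: 
  assumes "f \<in> V" shows "(\<lambda>x. c + d * f x) \<in> V"
proof -
  have V': "fun_vs.subspace V"
    using V by (simp add: finite_dimensional_poly_space_def)
  have "(\<lambda>x. c * 1) + (\<lambda>x. d * f x) \<in> V"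
    using fun_vs.subspace_scale[OF V' one] fun_vs.subspace_scale[OF V' assms]
    by (rule fun_vs.subspace_add[OF V'])
  then show ?thesis by (simp add: plus_fun_def)
qed

lemma cell_integrable:
  fixes f :: "real ^ 'd \<Rightarrow> real"
  shows "continuous_on UNIV f \<Longrightarrow> set_integrable lborel K f"
  using compact emeasure_compact_finite by (intro set_integrable_continuous_compact) auto

lemma boundary_integrable:
  fixes f :: "real ^ 'd \<Rightarrow> real"
  shows "continuous_on UNIV f \<Longrightarrow> set_integrable (hausdorff_measure (CARD('d) - 1)) (frontier K) f"
  using compact area by (intro set_integrable_continuous_compact) (auto simp: boundary_area_def)

lemma cell_integral_affine: "f \<in> V \<Longrightarrow> 
   cell_integral K (\<lambda>x. c + d * f x) = c * cell_integral K (\<lambda>x. 1) + d * cell_integral K f"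
  using set_integral_add(2)[OF cell_integrable cell_integrable, of "\<lambda>x. c" "\<lambda>x. d * f x"]
    set_integral_mult_right[of lborel K c "\<lambda>x. 1"]
  by (simp add: cell_integral_def continuous continuous_on_mult)

lemma boundary_integral_affine: "f \<in> V \<Longrightarrow> 
   boundary_integral K (\<lambda>x. c + d * f x) = c * boundary_integral K (\<lambda>x. 1) + d * boundary_integral K f"
  using set_integral_add(2)[OF boundary_integrable boundary_integrable, of "\<lambda>x. c" "\<lambda>x. d * f x"]
    set_integral_mult_right[of "hausdorff_measure (CARD('d) - 1)" "frontier K" c "\<lambda>x. 1"]
  by (simp add: boundary_integral_def continuous continuous_on_mult)

lemma retentional_affine: "f \<in> V \<Longrightarrow> 
   retentional K M (\<lambda>x. c + d * f x) = c * retentional K M (\<lambda>x. 1) + d * retentional K M f"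
  by (simp add: retentional_def cell_integral_affine boundary_integral_affine algebra_simps)

lemma volume_pos: "0 < measure lborel K"
proof -
  have "(LINT x:K|lborel. \<bar>1::real\<bar>) \<noteq> 0"
    using zero_on_interior_if_integral_abs_zero[OF compact, of "\<lambda>x. 1"] interior by auto
  then have "measure lborel K \<noteq> 0"
    using compact emeasure_compact_finite[OF compact] by (simp add: set_integral_const compact_imp_closed)
  then show ?thesis by (simp add: order_less_le)
qed

lemma cell_integral_one: "cell_integral K (\<lambda>x. 1) = measure lborel K"
  using compact emeasure_compact_finite[OF compact]
  by (simp add: cell_integral_def set_integral_const compact_imp_closed)

lemma cell_average_affine: "f \<in> V \<Longrightarrow> cell_average K (\<lambda>x. c + d * f x) = c + d * cell_average K f"
  using volume_pos by (simp add: cell_average_def cell_integral_affine cell_integral_one add_divide_distrib)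

section \<open>Supremum and average of nonnegative polynomials\<close>

text \<open>
  In coordinates with respect to a basis of \<open>V\<close>, the \<open>L\<^sup>1\<close> norm over \<open>K\<close> is a seminorm. It
  is definite because a polynomial that vanishes on the nonempty interior of \<open>K\<close> is zero. So it
  bounds the coefficients, which in turn bound the supremum over \<open>K\<close>.
\<close>

lemma sup_le_average:
  "\<exists>C\<ge>1. \<forall>f\<in>V. (\<forall>y\<in>K. 0 \<le> f y) \<longrightarrow> (\<forall>x\<in>K. f x \<le> C * cell_average K f)"
proof -
  obtain F where F: "finite F" "fun_vs.span F = V"
    using V by (auto simp: finite_dimensional_poly_space_def)
  obtain B where B: "B \<subseteq> F" "fun_vs.independent B" "F \<subseteq> fun_vs.span B"
    by (rule fun_vs.maximal_independent_subset)
  have fin: "finite B"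
    using B F by (auto intro: finite_subset)
  have span: "fun_vs.span B = V"
    using B F by (metis fun_vs.span_eq fun_vs.span_mono fun_vs.span_span subset_antisym)
  define p where "p a = (\<lambda>x. \<Sum>b\<in>B. a b * b x)" for a :: "(real ^ 'd \<Rightarrow> real) \<Rightarrow> real"
  have p_eq: "p a = (\<Sum>b\<in>B. (\<lambda>x. a b * b x))" for a
    by (simp add: p_def fun_eq_iff sum_fun_apply)
  have range: "range p = V"
    unfolding span[symmetric] fun_vs.span_finite[OF fin] p_eq[abs_def] ..
  then have pV: "p a \<in> V" for a
    by blast
  define \<nu> where "\<nu> a = (LINT x:K|lborel. \<bar>p a x\<bar>)" for a
  have integrable: "set_integrable lborel K (\<lambda>x. \<bar>p a x\<bar>)" for a
    using continuous[OF pV] by (intro cell_integrable continuous_intros)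
  have "\<exists>C. \<forall>a. (\<Sum>b\<in>B. \<bar>a b\<bar>) \<le> C * \<nu> a"
  proof (rule definite_seminorm_bounds_coefficients[OF fin])
    fix c a
    have "p (\<lambda>b. c * a b) x = c * p a x" for x
      by (simp add: p_def sum_distrib_left mult.assoc)
    then show "\<nu> (\<lambda>b. c * a b) = \<bar>c\<bar> * \<nu> a"
      by (simp add: \<nu>_def abs_mult)
  next
    fix a a'
    have "p (\<lambda>b. a b + a' b) x = p a x + p a' x" for x
      by (simp add: p_def sum.distrib distrib_right)
    then have "\<nu> (\<lambda>b. a b + a' b) \<le> (LINT x:K|lborel. \<bar>p a x\<bar> + \<bar>p a' x\<bar>)"
      unfolding \<nu>_def using integrable[of "\<lambda>b. a b + a' b"]
      by (intro set_integral_mono set_integral_add(1) integrable) auto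
    then show "\<nu> (\<lambda>b. a b + a' b) \<le> \<nu> a + \<nu> a'"
      unfolding \<nu>_def by (simp add: set_integral_add(2) integrable)
  next
    fix a a' :: "(real ^ 'd \<Rightarrow> real) \<Rightarrow> real" assume "\<And>b. b \<in> B \<Longrightarrow> a b = a' b"
    then have "p a = p a'" unfolding p_def by (simp cong: sum.cong)
    then show "\<nu> a = \<nu> a'" by (simp add: \<nu>_def)
  next
    fix a b assume "\<nu> a = 0" "b \<in> B"
    then have "p a x = 0" if "x \<in> interior K" for x
      using zero_on_interior_if_integral_abs_zero[OF compact continuous[OF pV] _ that]
      by (simp add: \<nu>_def)
    then have "p a = 0"
      using real_polynomial_function_zero_if_zero_on_open[OF poly[OF pV] open_interior interior]
      by fastforce
    then show "a b = 0"
      using B(2) \<open>b \<in> B\<close> fin unfolding fun_vs.dependent_finite[OF fin] p_eq by blast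
  qed
  then obtain C1 where C1: "\<And>a. (\<Sum>b\<in>B. \<bar>a b\<bar>) \<le> C1 * \<nu> a"
    by blast
  have "bounded (b ` K)" if "b \<in> B" for b
    using that span fun_vs.span_base compact continuous
    by (intro compact_imp_bounded compact_continuous_image) auto
  then have "bounded (\<Union>b\<in>B. b ` K)"
    using fin by (intro bounded_UN) auto
  then obtain C2 where "\<forall>y\<in>(\<Union>b\<in>B. b ` K). \<bar>y\<bar> \<le> C2"
    by (auto simp: bounded_iff)
  then have C2: "\<bar>b x\<bar> \<le> C2" if "b \<in> B" "x \<in> K" for b x
    using that by auto
  \<comment> \<open>The volume turns the integral into the average. Making \<open>C\<close> at least 1 lets the same
    constant bound the average itself in the deviation estimate.\<close>
  define C where "C = max 1 (\<bar>C2\<bar> * \<bar>C1\<bar> * measure lborel K)"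
  have "f x \<le> C * cell_average K f" if f: "f \<in> V" "\<And>y. y \<in> K \<Longrightarrow> 0 \<le> f y" and x: "x \<in> K" for f x
  proof -
    obtain a where a: "f = p a"
      using f(1) range by blast
    have \<nu>: "\<nu> a = cell_integral K f"
      unfolding \<nu>_def cell_integral_def a[symmetric] using f(2) compact
      by (intro set_lebesgue_integral_cong) (auto simp: compact_imp_closed)
    have \<nu>0: "0 \<le> \<nu> a"
      unfolding \<nu>_def set_lebesgue_integral_def by (intro integral_nonneg_AE) auto
    have "f x \<le> (\<Sum>b\<in>B. \<bar>a b\<bar> * \<bar>b x\<bar>)"
      unfolding a p_def by (intro sum_mono) (metis abs_ge_self abs_mult)
    also have "\<dots> \<le> (\<Sum>b\<in>B. \<bar>a b\<bar> * \<bar>C2\<bar>)"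
      using C2 x by (intro sum_mono mult_left_mono) force+
    also have "\<dots> = \<bar>C2\<bar> * (\<Sum>b\<in>B. \<bar>a b\<bar>)"
      by (simp add: sum_distrib_left mult.commute)
    also have "\<dots> \<le> \<bar>C2\<bar> * (\<bar>C1\<bar> * \<nu> a)"
      using C1[of a] mult_right_mono[OF abs_ge_self[of C1] \<nu>0] by (intro mult_left_mono) auto
    also have "\<dots> = (\<bar>C2\<bar> * \<bar>C1\<bar> * measure lborel K) * cell_average K f"
      using volume_pos by (simp add: cell_average_def \<nu>)
    also have "\<dots> \<le> C * cell_average K f"
      using \<nu>0 by (intro mult_right_mono) (auto simp: C_def cell_average_def \<nu>)
    finally show ?thesis .
  qed
  moreover have "1 \<le> C"
    by (simp add: C_def)
  ultimately show ?thesis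
    by blast
qed

section \<open>The limiter\<close>

text \<open>
  If the cell integral is positive, this is the definition of the optimal interior weight. Otherwise
  the polynomial vanishes on \<open>K\<close>, which contains its frontier, and both integrals are zero.
\<close>

lemma retentional_nonneg:
  assumes M: "optimal_interior_weight K V \<le> ereal M" and f: "f \<in> V" "\<And>x. x \<in> K \<Longrightarrow> 0 \<le> f x"
  shows "0 \<le> retentional K M f"
proof (cases "0 < cell_integral K f")
  case True
  then have "f \<in> positive_polys K V"
    using f by (simp add: positive_polys_def)
  then have "ereal (boundary_integral K f / cell_integral K f) \<le> optimal_interior_weight K V"
    unfolding optimal_interior_weight_def by (rule SUP_upper)
  then have "boundary_integral K f / cell_integral K f \<le> M"
    using M by (metis ereal_less_eq(3) order_trans)
  then show ?thesis
    using True by (simp add: retentional_def field_simps)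
next
  case False
  obtain C where C: "1 \<le> C"
    "\<And>f x. f \<in> V \<Longrightarrow> (\<And>y. y \<in> K \<Longrightarrow> 0 \<le> f y) \<Longrightarrow> x \<in> K \<Longrightarrow> f x \<le> C * cell_average K f"
    using sup_le_average by blast
  have "0 \<le> cell_integral K f"
    unfolding cell_integral_def set_lebesgue_integral_def
    using f by (intro integral_nonneg_AE) (auto simp: indicator_def)
  with False have 0: "cell_integral K f = 0" by simp
  have zero: "f x = 0" if "x \<in> K" for x
    using C(2)[OF f(1) f(2) that] f(2)[OF that] by (simp add: cell_average_def 0)
  have "frontier K \<subseteq> K"
    using compact by (simp add: compact_imp_closed frontier_subset_closed)
  then have "boundary_integral K f = (LINT x:frontier K|hausdorff_measure (CARD('d) - 1). 0)"
    unfolding boundary_integral_def using zero compact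
    by (intro set_lebesgue_integral_cong) auto
  then show ?thesis
    by (simp add: retentional_def 0)
qed

text \<open>
  The second claim is multiplied out, rather than a bound on the amount \<open>1 - \<theta>\<close> of damping, since
  it then also covers \<open>A + \<epsilon> = 0\<close> and has the form in which \<open>A + \<epsilon>\<close> cancels later.
\<close>

lemma damping_le:
  assumes M: "optimal_interior_weight K V \<le> ereal M" and U: "U \<in> V"
    and avg: "0 \<le> cell_average K U" and \<epsilon>: "0 \<le> \<epsilon>" "\<And>x. x \<in> K \<Longrightarrow> - \<epsilon> \<le> U x"
  shows "damping_factor K M U \<in> {0..1}"
    and "(1 - damping_factor K M U) * (cell_average K U + \<epsilon>) \<le> \<epsilon>"
proof -
  define A where "A = cell_average K U"
  define r where "r = retentional K M (\<lambda>x. 1)"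
  define \<rho> where "\<rho> = retentional K M U"
  have ret: "retentional K M (damp K t U) = (1 - t) * (A * r) + t * \<rho>" for t
  proof -
    have "damp K t U = (\<lambda>x. (1 - t) * A + t * U x)"
      by (simp add: damp_def A_def algebra_simps)
    then show ?thesis
      using U by (simp add: retentional_affine r_def \<rho>_def)
  qed
  have "0 \<le> r"
    unfolding r_def by (rule retentional_nonneg[OF M one]) simp
  have "0 \<le> retentional K M (\<lambda>x. \<epsilon> + 1 * U x)"
    by (rule retentional_nonneg[OF M combination[OF U]]) (use \<epsilon>(2) in force)
  then have \<rho>: "0 \<le> \<epsilon> * r + \<rho>"
    by (subst (asm) retentional_affine[OF U]) (simp add: r_def \<rho>_def)
  have "0 \<le> A" using avg by (simp add: A_def)
  have pos: "0 < A * r - \<rho>" if "\<not> 0 \<le> \<rho>"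
    using that mult_nonneg_nonneg[OF \<open>0 \<le> A\<close> \<open>0 \<le> r\<close>] by simp
  \<comment> \<open>If \<open>\<rho> < 0\<close>, the affine function of \<open>t\<close> in \<open>ret\<close> is decreasing and \<open>s\<close> is its root.\<close>
  define s where "s = (if 0 \<le> \<rho> then 1 else A * r / (A * r - \<rho>))"
  have s: "s \<in> {0..1} \<and> 0 \<le> retentional K M (damp K s U)"
  proof (cases "0 \<le> \<rho>")
    case False
    then have "0 < A * r - \<rho>" by (rule pos)
    then show ?thesis
      using False \<open>0 \<le> A\<close> \<open>0 \<le> r\<close> unfolding ret s_def by (simp add: field_simps)
  qed (simp add: s_def ret)
  have df: "damping_factor K M U = s"
    unfolding damping_factor_def
  proof (rule Greatest_equality)
    show "s \<in> {0..1} \<and> 0 \<le> retentional K M (damp K s U)"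
      by (rule s)
  next
    fix t assume t: "t \<in> {0..1} \<and> 0 \<le> retentional K M (damp K t U)"
    show "t \<le> s"
    proof (cases "0 \<le> \<rho>")
      case False
      then have "0 < A * r - \<rho>" by (rule pos)
      then show ?thesis using t False unfolding ret s_def by (simp add: field_simps)
    qed (use t in \<open>simp add: s_def\<close>)
  qed
  show "damping_factor K M U \<in> {0..1}" using s df by simp
  show "(1 - damping_factor K M U) * (cell_average K U + \<epsilon>) \<le> \<epsilon>"
  proof (cases "0 \<le> \<rho>")
    case True
    then show ?thesis using \<epsilon>(1) by (simp add: df s_def)
  next
    case False
    then have pos: "0 < A * r - \<rho>" by (rule pos)
    then have s_eq: "1 - s = - \<rho> / (A * r - \<rho>)"
      using False by (simp add: s_def field_simps)
    \<comment> \<open>After subtracting \<open>- \<epsilon> * \<rho>\<close> from both sides, this is \<open>A\<close> times the fact \<open>\<rho>\<close>.\<close>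
    have "- \<rho> * (A + \<epsilon>) \<le> \<epsilon> * (A * r - \<rho>)"
      using mult_left_mono[OF \<rho> \<open>0 \<le> A\<close>] by (simp add: algebra_simps)
    then show ?thesis
      unfolding df A_def[symmetric] s_eq using pos
      by (simp only: times_divide_eq_left pos_divide_le_eq)
  qed
qed

text \<open>
  The limiter moves \<open>U x\<close> by \<open>(1 - \<theta>) (A - U x)\<close>, where \<open>A - U x\<close> is the difference of
  \<open>A + \<epsilon>\<close> and \<open>U x + \<epsilon>\<close>. Both of these lie between 0 and \<open>C (A + \<epsilon>)\<close>, and
  \<open>damping_le\<close> bounds \<open>(1 - \<theta>) (A + \<epsilon>)\<close>.
\<close>

lemma limited_deviation_le:
  assumes C: "1 \<le> C" "\<And>f x. f \<in> V \<Longrightarrow> (\<And>y. y \<in> K \<Longrightarrow> 0 \<le> f y) \<Longrightarrow> x \<in> K \<Longrightarrow> f x \<le> C * cell_average K f"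
    and M: "optimal_interior_weight K V \<le> ereal M" and U: "U \<in> V"
    and avg: "0 \<le> cell_average K U" and \<epsilon>: "0 \<le> \<epsilon>" "\<And>y. y \<in> K \<Longrightarrow> - \<epsilon> \<le> U y" and x: "x \<in> K"
  shows "\<bar>limited K M U x - U x\<bar> \<le> C * \<epsilon>"
proof -
  define A where "A = cell_average K U"
  define \<theta> where "\<theta> = damping_factor K M U"
  note \<theta> = damping_le[OF M U avg \<epsilon>, folded A_def \<theta>_def]
  have "\<epsilon> + 1 * U x \<le> C * cell_average K (\<lambda>x. \<epsilon> + 1 * U x)"
    by (rule C(2)[OF combination[OF U] _ x]) (use \<epsilon>(2) in force)
  then have "\<epsilon> + U x \<le> C * (A + \<epsilon>)"
    by (subst (asm) cell_average_affine[OF U]) (simp add: A_def add.commute)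
  moreover have "A + \<epsilon> \<le> C * (A + \<epsilon>)"
    using mult_right_mono[OF C(1), of "A + \<epsilon>"] avg \<epsilon>(1) by (simp add: A_def)
  moreover have "0 \<le> \<epsilon> + U x" "0 \<le> A + \<epsilon>"
    using \<epsilon> x avg by (force simp: A_def)+
  ultimately have dev: "\<bar>A - U x\<bar> \<le> C * (A + \<epsilon>)"
    by linarith
  have "limited K M U x - U x = (1 - \<theta>) * (A - U x)"
    by (simp add: limited_def damp_def A_def \<theta>_def algebra_simps)
  then have "\<bar>limited K M U x - U x\<bar> = (1 - \<theta>) * \<bar>A - U x\<bar>"
    using \<theta>(1) by (simp add: abs_mult)
  also have "\<dots> \<le> (1 - \<theta>) * (C * (A + \<epsilon>))"
    using \<theta>(1) dev by (intro mult_left_mono) auto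
  also have "\<dots> = C * ((1 - \<theta>) * (A + \<epsilon>))"
    by simp
  also have "\<dots> \<le> C * \<epsilon>"
    using \<theta>(2) C(1) by (intro mult_left_mono) auto
  finally show ?thesis .
qed

end

theorem theorem5p2:
  fixes K :: "(real ^ 'd) set" and V :: "(real ^ 'd \<Rightarrow> real) set" and k :: nat
    and M \<delta>0 :: real and u U :: "real \<Rightarrow> real ^ 'd \<Rightarrow> real"
  assumes "compact K" and "interior K \<noteq> {}"
    and "0 < boundary_area K" and "boundary_area K < \<infinity>"
    and "finite_dimensional_poly_space V" and "polys_of_degree_le k \<subseteq> V"
    and "optimal_interior_weight K V \<le> ereal M"
    and "0 < \<delta>0"
    and "\<And>\<delta> x. 0 < \<delta> \<Longrightarrow> \<delta> \<le> \<delta>0 \<Longrightarrow> x \<in> K \<Longrightarrow> 0 \<le> u \<delta> x"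
    and "\<And>\<delta>. 0 < \<delta> \<Longrightarrow> \<delta> \<le> \<delta>0 \<Longrightarrow> U \<delta> \<in> V"
    and "\<And>\<delta>. 0 < \<delta> \<Longrightarrow> \<delta> \<le> \<delta>0 \<Longrightarrow> 0 \<le> cell_average K (U \<delta>)"
    and "sup_error_bigo K (k + 1) U u"
  shows "sup_error_bigo K (k + 1) (\<lambda>\<delta>. limited K M (U \<delta>)) u"
proof -
  \<comment> \<open>The constant 1 is the monomial with all exponents zero.\<close>
  have "(\<lambda>x. \<Prod>i\<in>UNIV. (x $ i) ^ (\<lambda>_. 0) i) \<in> (polys_of_degree_le k :: (real ^ 'd \<Rightarrow> real) set)"
    unfolding polys_of_degree_le_def by (intro fun_vs.span_base CollectI exI[of _ "\<lambda>_. 0"]) auto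
  then have "(\<lambda>x. 1) \<in> V"
    using assms(6) by auto
  then interpret mesh_cell K V
    using assms by unfold_locales
  obtain C where C: "1 \<le> C"
    "\<And>f x. f \<in> V \<Longrightarrow> (\<And>y. y \<in> K \<Longrightarrow> 0 \<le> f y) \<Longrightarrow> x \<in> K \<Longrightarrow> f x \<le> C * cell_average K f"
    using sup_le_average by blast
  obtain E where E: "\<forall>\<^sub>F \<delta> in at_right 0. (SUP x\<in>K. ereal \<bar>U \<delta> x - u \<delta> x\<bar>) \<le> ereal (E * \<delta> ^ (k + 1))"
    using assms(12) unfolding sup_error_bigo_def by blast
  have "\<forall>\<^sub>F \<delta> in at_right 0. 0 < \<delta> \<and> \<delta> \<le> \<delta>0"
    using eventually_at_right_real[OF assms(8)] by (rule eventually_mono) auto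
  with E have "\<forall>\<^sub>F \<delta> in at_right 0.
      (SUP x\<in>K. ereal \<bar>limited K M (U \<delta>) x - u \<delta> x\<bar>) \<le> ereal ((C + 1) * E * \<delta> ^ (k + 1))"
  proof eventually_elim
    case (elim \<delta>)
    then have \<delta>: "0 < \<delta>" "\<delta> \<le> \<delta>0"
      by auto
    define \<epsilon> where "\<epsilon> = E * \<delta> ^ (k + 1)"
    have err: "\<bar>U \<delta> x - u \<delta> x\<bar> \<le> \<epsilon>" if "x \<in> K" for x
      using elim that by (auto simp: SUP_le_iff \<epsilon>_def)
    then have "0 \<le> \<epsilon>"
      using nonempty by (meson abs_ge_zero ex_in_conv order_trans)
    have low: "- \<epsilon> \<le> U \<delta> x" if "x \<in> K" for x
      using err[OF that] assms(9)[OF \<delta> that] by linarith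
    have "\<bar>limited K M (U \<delta>) x - u \<delta> x\<bar> \<le> (C + 1) * \<epsilon>" if "x \<in> K" for x
      using limited_deviation_le[OF C assms(7) assms(10)[OF \<delta>] assms(11)[OF \<delta>] \<open>0 \<le> \<epsilon>\<close> low that] err[OF that]
      by (simp add: distrib_right)
    then show ?case
      by (auto simp: SUP_le_iff \<epsilon>_def mult.assoc)
  qed
  then show ?thesis
    unfolding sup_error_bigo_def by blast
qed

end
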